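(* Let $T$ be a moon polyomino with $s$ rows and $t$ columns, and let $A$ be a set of positive integers. For every $s$-tuple $\mathbf{m}=(m_1,\ldots,m_s)$ of integers, $$\sum_{F\in \mathcal{N}(T,\mathbf{m};A)}p^{\mathrm{ne}_2(F)}q^{\mathrm{se}_2(F)}=\sum_{F\in \mathcal{N}(T,\mathbf{m};A)}p^{\mathrm{se}_2(F)}q^{\mathrm{ne}_2(F)},$$ and for every $t$-tuple $\mathbf{m}=(m_1,\ldots,m_t)$ of integers, $$\sum_{F\in \mathcal{N}'(T,\mathbf{m};A)}p^{\mathrm{ne}_2(F)}q^{\mathrm{se}_2(F)}=\sum_{F\in \mathcal{N}'(T,\mathbf{m};A)}p^{\mathrm{se}_2(F)}q^{\mathrm{ne}_2(F)},$$ as identities of polynomials in the indeterminates $p,q$. That is, the joint statistic $(\mathrm{ne}_2,\mathrm{se}_2)$ is symmetrically distributed over each $\mathcal{N}(T,\mathbf{m};A)$ and each $\mathcal{N}'(T,\mathbf{m};A)$.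
   Context: A polyomino is a finite nonempty arrangement (set) of unit square cells of the square grid. It is convex if no row and no column of cells has a hole (if two cells of the same row, or of the same column, belong to it, so do all cells between them). It is intersection free if any two of its rows are comparable, i.e. one can be embedded in the other by a vertical shift (the set of columns met by one row is contained in the set of columns met by the other). A moon polyomino is a convex and intersection free polyomino. Its rows are labelled $1,\ldots,s$ from top to bottom and its columns $1,\ldots,t$ from left to right. A $01$-filling $F$ of $T$ assigns $0$ or $1$ to each cell of $T$; a row or column is empty if all its cells are assigned $0$. $\mathrm{EC}(F)$ (resp. $\mathrm{ER}(F)$) is the set of labels of the empty columns (resp. empty rows) of $F$. For $\mathbf{m}=(m_1,\ldots,m_s)$, $\mathcal{N}(T,\mathbf{m})$ is the set of $01$-fillings of $T$ with exactly $m_i$ $1$'s in row $i$ for each $i$ and at most one $1$ in each column; $\mathcal{N}(T,\mathbf{m};A)$ is the set of $F\in\mathcal{N}(T,\mathbf{m})$ with $\mathrm{EC}(F)=A$. For $\mathbf{m}=(m_1,\ldots,m_t)$, $\mathcal{N}'(T,\mathbf{m})$ is the set of $01$-fillings of $T$ with exactly $m_i$ $1$'s in column $i$ for each $i$ and at most one $1$ in each row; $\mathcal{N}'(T,\mathbf{m};A)$ is the set of $F\in\mathcal{N}'(T,\mathbf{m})$ with $\mathrm{ER}(F)=A$. An ascent (resp. descent) of $F$ is a set of two $1$'s of $F$ such that one of them is strictly above and strictly to the right (resp. strictly below and strictly to the right) of the other and the smallest rectangle of cells containing the two $1$'s is contained in $T$. $\mathrm{ne}_2(F)$ and $\mathrm{se}_2(F)$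 denote the numbers of ascents and of descents of $F$. *)

theory Defs
  imports "HOL-Library.FuncSet" "HOL-Computational_Algebra.Polynomial"
begin

text \<open>Matrix convention: a cell is a pair (row, column) of grid coordinates; row coordinates
  grow downwards and column coordinates grow to the right.\<close>

type_synonym cell = "int \<times> int"

definition rows :: "cell set \<Rightarrow> int set" where
  "rows T = fst ` T"

definition columns :: "cell set \<Rightarrow> int set" where
  "columns T = snd ` T"

definition polyomino :: "cell set \<Rightarrow> bool" where
  "polyomino T \<longleftrightarrow> finite T \<and> T \<noteq> {}"

definition convex_polyomino :: "cell set \<Rightarrow> bool" where
  "convex_polyomino T \<longleftrightarrow> polyomino T \<and>
     (\<forall>x y y' z. (x, y) \<in> T \<and> (x, y') \<in> T \<and> y \<le> z \<and> z \<le> y' \<longrightarrow> (x, z) \<in> T) \<and>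
     (\<forall>x x' y z. (x, y) \<in> T \<and> (x', y) \<in> T \<and> x \<le> z \<and> z \<le> x' \<longrightarrow> (z, y) \<in> T)"

definition intersection_free :: "cell set \<Rightarrow> bool" where
  "intersection_free T \<longleftrightarrow> (\<forall>x\<in>rows T. \<forall>x'\<in>rows T.
     {y. (x, y) \<in> T} \<subseteq> {y. (x', y) \<in> T} \<or> {y. (x', y) \<in> T} \<subseteq> {y. (x, y) \<in> T})"

definition moon_polyomino :: "cell set \<Rightarrow> bool" where
  "moon_polyomino T \<longleftrightarrow> convex_polyomino T \<and> intersection_free T"

definition num_rows :: "cell set \<Rightarrow> nat" where
  "num_rows T = card (rows T)"

definition num_columns :: "cell set \<Rightarrow> nat" where
  "num_columns T = card (columns T)"

text \<open>Position of the row with grid coordinate \<open>x\<close> counted from the top, and of the column with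
  grid coordinate \<open>y\<close> counted from the left, both starting at 1.\<close>

definition row_label :: "cell set \<Rightarrow> int \<Rightarrow> nat" where
  "row_label T x = card {x' \<in> rows T. x' \<le> x}"

definition column_label :: "cell set \<Rightarrow> int \<Rightarrow> nat" where
  "column_label T y = card {y' \<in> columns T. y' \<le> y}"

text \<open>Fillings are extensional functions (undefined off \<open>T\<close>), so that they are determined by
  their values on \<open>T\<close> and there are finitely many of them.\<close>

definition fillings :: "cell set \<Rightarrow> (cell \<Rightarrow> nat) set" where
  "fillings T = T \<rightarrow>\<^sub>E {0, 1}"

definition ones :: "cell set \<Rightarrow> (cell \<Rightarrow> nat) \<Rightarrow> cell set" where
  "ones T F = {c \<in> T. F c = 1}"

definition row_count :: "cell set \<Rightarrow> (cell \<Rightarrow> nat) \<Rightarrow> nat \<Rightarrow> nat" where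
  "row_count T F i = card {c \<in> ones T F. row_label T (fst c) = i}"

definition column_count :: "cell set \<Rightarrow> (cell \<Rightarrow> nat) \<Rightarrow> nat \<Rightarrow> nat" where
  "column_count T F j = card {c \<in> ones T F. column_label T (snd c) = j}"

definition ER :: "cell set \<Rightarrow> (cell \<Rightarrow> nat) \<Rightarrow> nat set" where
  "ER T F = row_label T ` {x \<in> rows T. \<forall>c\<in>T. fst c = x \<longrightarrow> F c = 0}"

definition EC :: "cell set \<Rightarrow> (cell \<Rightarrow> nat) \<Rightarrow> nat set" where
  "EC T F = column_label T ` {y \<in> columns T. \<forall>c\<in>T. snd c = y \<longrightarrow> F c = 0}"

text \<open>A tuple is a function on labels of which only the values at \<open>{1..s}\<close>, respectively
  \<open>{1..t}\<close>, are used.\<close>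

definition N_fillings :: "cell set \<Rightarrow> (nat \<Rightarrow> int) \<Rightarrow> (cell \<Rightarrow> nat) set" where
  "N_fillings T m = {F \<in> fillings T.
     (\<forall>i\<in>{1..num_rows T}. int (row_count T F i) = m i) \<and>
     (\<forall>j\<in>{1..num_columns T}. column_count T F j \<le> 1)}"

definition N_fillings_EC :: "cell set \<Rightarrow> (nat \<Rightarrow> int) \<Rightarrow> nat set \<Rightarrow> (cell \<Rightarrow> nat) set" where
  "N_fillings_EC T m A = {F \<in> N_fillings T m. EC T F = A}"

definition N'_fillings :: "cell set \<Rightarrow> (nat \<Rightarrow> int) \<Rightarrow> (cell \<Rightarrow> nat) set" where
  "N'_fillings T m = {F \<in> fillings T.
     (\<forall>j\<in>{1..num_columns T}. int (column_count T F j) = m j) \<and>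
     (\<forall>i\<in>{1..num_rows T}. row_count T F i \<le> 1)}"

definition N'_fillings_ER :: "cell set \<Rightarrow> (nat \<Rightarrow> int) \<Rightarrow> nat set \<Rightarrow> (cell \<Rightarrow> nat) set" where
  "N'_fillings_ER T m A = {F \<in> N'_fillings T m. ER T F = A}"

definition bounding_rectangle :: "cell \<Rightarrow> cell \<Rightarrow> cell set" where
  "bounding_rectangle c d =
     {min (fst c) (fst d)..max (fst c) (fst d)} \<times> {min (snd c) (snd d)..max (snd c) (snd d)}"

definition ascents :: "cell set \<Rightarrow> (cell \<Rightarrow> nat) \<Rightarrow> cell set set" where
  "ascents T F = {{c, d} | c d. c \<in> ones T F \<and> d \<in> ones T F \<and>
     fst d < fst c \<and> snd c < snd d \<and> bounding_rectangle c d \<subseteq> T}"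

definition descents :: "cell set \<Rightarrow> (cell \<Rightarrow> nat) \<Rightarrow> cell set set" where
  "descents T F = {{c, d} | c d. c \<in> ones T F \<and> d \<in> ones T F \<and>
     fst c < fst d \<and> snd c < snd d \<and> bounding_rectangle c d \<subseteq> T}"

definition ne2 :: "cell set \<Rightarrow> (cell \<Rightarrow> nat) \<Rightarrow> nat" where
  "ne2 T F = card (ascents T F)"

definition se2 :: "cell set \<Rightarrow> (cell \<Rightarrow> nat) \<Rightarrow> nat" where
  "se2 T F = card (descents T F)"

text \<open>The polynomial ring in two indeterminates is $(\mathbb{Z}[p])[q]$.\<close>

definition indet_p :: "int poly poly" where
  "indet_p = [:[:0, 1:]:]"

definition indet_q :: "int poly poly" where
  "indet_q = [:0, 1:]"

lemma finite_fillings: "finite T \<Longrightarrow> finite (fillings T)"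
  unfolding fillings_def by (intro finite_PiE) auto

lemma finite_N_fillings_EC: "finite T \<Longrightarrow> finite (N_fillings_EC T m A)"
  using finite_fillings[of T] unfolding N_fillings_EC_def N_fillings_def by simp

lemma finite_N'_fillings_ER: "finite T \<Longrightarrow> finite (N'_fillings_ER T m A)"
  using finite_fillings[of T] unfolding N'_fillings_ER_def N'_fillings_def by simp

lemma rank_bij_betw:
  fixes S :: "int set"
  assumes "finite S"
  shows "bij_betw (\<lambda>x. card {x' \<in> S. x' \<le> x}) S {1..card S}"
proof -
  let ?r = "\<lambda>x. card {x' \<in> S. x' \<le> x}"
  have lt: "?r x < ?r y" if "x < y" "y \<in> S" for x y
  proof (rule psubset_card_mono)
    show "finite {x' \<in> S. x' \<le> y}" using assms by simp
    have "y \<in> {x' \<in> S. x' \<le> y} - {x' \<in> S. x' \<le> x}" using that by simp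
    then show "{x' \<in> S. x' \<le> x} \<subset> {x' \<in> S. x' \<le> y}" using that by force
  qed
  have inj: "inj_on ?r S"
  proof (rule inj_onI)
    fix x y assume "x \<in> S" "y \<in> S" "?r x = ?r y"
    then show "x = y" using lt[of x y] lt[of y x] by (cases x y rule: linorder_cases) simp_all
  qed
  have "?r ` S \<subseteq> {1..card S}"
  proof (rule image_subsetI)
    fix x assume "x \<in> S"
    then have "{x' \<in> S. x' \<le> x} \<noteq> {}" by blast
    then have "?r x \<noteq> 0" using assms by (subst card_0_eq) simp_all
    moreover have "?r x \<le> card S" by (rule card_mono[OF assms]) blast
    ultimately show "?r x \<in> {1..card S}" by simp
  qed
  moreover have "card (?r ` S) = card {1..card S}" by (simp only: card_image[OF inj] card_atLeastAtMost)
  ultimately have "?r ` S = {1..card S}" by (intro card_subset_eq) simp_all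
  with inj show ?thesis by (simp add: bij_betw_def)
qed

lemma row_label_bij_betw: "finite T \<Longrightarrow> bij_betw (row_label T) (rows T) {1..num_rows T}"
  using rank_bij_betw[of "rows T"] by (simp add: row_label_def[abs_def] num_rows_def rows_def)

lemma column_label_bij_betw:
  "finite T \<Longrightarrow> bij_betw (column_label T) (columns T) {1..num_columns T}"
  using rank_bij_betw[of "columns T"]
  by (simp add: column_label_def[abs_def] num_columns_def columns_def)

end

theory Submission
  imports Defs
begin

text \<open>In a moon polyomino the shorter of the top and the bottom row is contained in all other rows.
  Let \<open>I\<close> be the set of columns it meets and \<open>X\<close> the set of nonempty columns in \<open>I\<close>. If its ones are in
  the columns \<open>S \<subseteq> X\<close>, the ones in the columns \<open>X - S\<close> all lie strictly on the same side of it, so its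
  ones contribute as many ascents and descents as there are pairs in \<open>S \<times> (X - S)\<close> of either relative
  order. The generating function of these numbers over all \<open>S \<subseteq> X\<close> of a given size depends only on
  the size of \<open>X\<close>, and reversing the order of \<open>X\<close> shows that it is symmetric in \<open>p\<close> and \<open>q\<close>. The other
  rows form a smaller moon polyomino, in which the columns of \<open>S\<close> are now empty; since all its rows
  contain \<open>I\<close>, the numbers of nonempty columns met by its rows do not depend on the choice of \<open>S\<close>.
  By induction, the generating function of \<open>(ne\<^sub>2, se\<^sub>2)\<close> is a product of symmetric factors. The second
  identity is the first one for the transposed polyomino.\<close>

section \<open>Symmetry of the generating function of subsets of given size\<close>

definition pairs_gt :: "int set \<Rightarrow> int set \<Rightarrow> nat" where
  "pairs_gt X S = card {(s, u). s \<in> S \<and> u \<in> X - S \<and> u < s}"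

definition pairs_lt :: "int set \<Rightarrow> int set \<Rightarrow> nat" where
  "pairs_lt X S = card {(s, u). s \<in> S \<and> u \<in> X - S \<and> s < u}"

text \<open>For finite \<open>X\<close> this is a homogeneous Gaussian binomial coefficient. The
  size \<open>k\<close> is an integer, like the prescribed row sums; a negative \<open>k\<close>
  gives the empty sum.\<close>

definition subset_gf :: "int set \<Rightarrow> int \<Rightarrow> 'a \<Rightarrow> 'a \<Rightarrow> 'a::comm_semiring_1" where
  "subset_gf X k p q = (\<Sum>S | S \<subseteq> X \<and> int (card S) = k. p ^ pairs_gt X S * q ^ pairs_lt X S)"

lemma ex_antitone_bij_betw:
  fixes X Y :: "int set"
  assumes "finite X" "finite Y" "card X = card Y"
  shows "\<exists>f. bij_betw f X Y \<and> (\<forall>x\<in>X. \<forall>y\<in>X. f x < f y \<longleftrightarrow> y < x)"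
proof -
  define r where "r Z x = card {x' \<in> Z. x' \<le> x}" for Z :: "int set" and x
  have bij: "bij_betw (r Z) Z {1..card Z}" if "finite Z" for Z
    using rank_bij_betw[OF that] by (simp add: r_def[abs_def])
  \<comment> \<open>Ranks are weakly monotone on all integers and injective on \<open>Z\<close>,
    hence strictly monotone on \<open>Z\<close>.\<close>
  have less: "r Z x < r Z y \<longleftrightarrow> x < y" if "finite Z" "x \<in> Z" "y \<in> Z" for Z x y
  proof -
    have "r Z x \<le> r Z y" if "x \<le> y" for x y
      unfolding r_def using \<open>finite Z\<close> that by (intro card_mono) auto
    moreover have "r Z x = r Z y \<longleftrightarrow> x = y"
      using bij[OF that(1)] that by (auto simp: bij_betw_def inj_on_def)
    ultimately show ?thesis
      by (metis linorder_not_less order_le_less order.asym)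
  qed
  let ?f = "\<lambda>x. inv_into Y (r Y) (r (uminus ` X) (- x))"
  have card: "card (uminus ` X) = card Y"
    using assms by (simp add: card_image)
  have "bij_betw uminus X (uminus ` X)"
    by (simp add: bij_betw_def)
  moreover have "bij_betw (r (uminus ` X)) (uminus ` X) {1..card Y}"
    using bij[of "uminus ` X"] assms card by simp
  moreover have "bij_betw (inv_into Y (r Y)) {1..card Y} Y"
    using bij[OF assms(2)] by (rule bij_betw_inv_into)
  ultimately have f: "bij_betw ?f X Y"
    using bij_betw_trans[of uminus X "uminus ` X"] bij_betw_trans by (fastforce simp: comp_def)
  have rf: "r Y (?f x) = r (uminus ` X) (- x)" if "x \<in> X" for x
    using that bij[OF assms(2)] bij[of "uminus ` X"] assms card
    by (intro f_inv_into_f) (auto simp: bij_betw_def)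
  have "?f x < ?f y \<longleftrightarrow> y < x" if "x \<in> X" "y \<in> X" for x y
  proof -
    have "?f x < ?f y \<longleftrightarrow> r Y (?f x) < r Y (?f y)"
      using that f assms by (subst less) (auto simp: bij_betw_def)
    also have "\<dots> \<longleftrightarrow> y < x"
      using that assms by (simp only: rf) (subst less, auto)
    finally show ?thesis .
  qed
  with f show ?thesis by blast
qed

lemma subset_gf_swap:
  assumes "finite X" "finite Y" "card X = card Y"
  shows "subset_gf X k p q = subset_gf Y k q p"
proof -
  obtain f where f: "bij_betw f X Y" and anti: "\<And>x y. x \<in> X \<Longrightarrow> y \<in> X \<Longrightarrow> f x < f y \<longleftrightarrow> y < x"
    using ex_antitone_bij_betw[OF assms] by blast
  have inj: "inj_on f X" and Y: "Y = f ` X"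
    using f by (auto simp: bij_betw_def)
  have card: "card (f ` S) = card S" if "S \<subseteq> X" for S
    using inj that by (meson card_image inj_on_subset)
  have diff: "f ` X - f ` S = f ` (X - S)" if "S \<subseteq> X" for S
    using inj that by (simp add: inj_on_image_set_diff)
  have gt: "pairs_gt (f ` X) (f ` S) = pairs_lt X S" if "S \<subseteq> X" for S
    unfolding pairs_gt_def pairs_lt_def diff[OF that]
    using that by (intro bij_betw_same_card[symmetric, where f = "map_prod f f"] bij_betw_imageI)
      (auto simp: inj_on_def anti subset_iff inj_onD[OF inj] image_iff)
  have lt: "pairs_lt (f ` X) (f ` S) = pairs_gt X S" if "S \<subseteq> X" for S
    unfolding pairs_gt_def pairs_lt_def diff[OF that]
    using that by (intro bij_betw_same_card[symmetric, where f = "map_prod f f"] bij_betw_imageI)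
      (auto simp: inj_on_def anti subset_iff inj_onD[OF inj] image_iff)
  have "bij_betw (image f) {S. S \<subseteq> X \<and> int (card S) = k} {S. S \<subseteq> Y \<and> int (card S) = k}"
  proof (rule bij_betw_imageI)
    show "inj_on (image f) {S. S \<subseteq> X \<and> int (card S) = k}"
      using inj by (auto simp: inj_on_def inj_on_image_eq_iff)
    show "image f ` {S. S \<subseteq> X \<and> int (card S) = k} = {S. S \<subseteq> Y \<and> int (card S) = k}"
      unfolding Y by (auto simp: subset_image_iff card)
  qed
  then show ?thesis
    unfolding subset_gf_def by (subst sum.reindex_bij_betw[symmetric])
      (auto simp: Y gt lt mult.commute intro!: sum.cong)
qed

section \<open>Configurations of ones and the removal of a row\<close>

definition row_columns :: "cell set \<Rightarrow> int \<Rightarrow> int set" where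
  "row_columns T x = {y. (x, y) \<in> T}"

definition remove_row :: "cell set \<Rightarrow> int \<Rightarrow> cell set" where
  "remove_row T x = {c \<in> T. fst c \<noteq> x}"

text \<open>Prescribing the nonempty columns \<open>Y\<close> instead of the empty ones makes the definition meaningful
  even when removing a row of \<open>T\<close> removes columns as well.\<close>

definition configurations :: "cell set \<Rightarrow> (int \<Rightarrow> int) \<Rightarrow> int set \<Rightarrow> cell set set" where
  "configurations T M Y = {C. C \<subseteq> T \<and> (\<forall>x\<in>rows T. int (card (row_columns C x)) = M x) \<and>
     inj_on snd C \<and> snd ` C = Y}"

text \<open>\<open>R\<close> is the vertical order of the left and the right cell: \<open>(>)\<close> for ascents, \<open>(<)\<close> for
  descents.\<close>

definition chain_pairs :: "(int \<Rightarrow> int \<Rightarrow> bool) \<Rightarrow> cell set \<Rightarrow> cell set \<Rightarrow> (cell \<times> cell) set" where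
  "chain_pairs R T C = {(c, d). c \<in> C \<and> d \<in> C \<and> R (fst c) (fst d) \<and> snd c < snd d \<and>
     bounding_rectangle c d \<subseteq> T}"

text \<open>With \<open>p\<close> and \<open>q\<close> as arguments in any commutative semiring,
  symmetry is expressed by exchanging the arguments.\<close>

definition configuration_gf ::
  "cell set \<Rightarrow> (int \<Rightarrow> int) \<Rightarrow> int set \<Rightarrow> 'a \<Rightarrow> 'a \<Rightarrow> 'a::comm_semiring_1" where
  "configuration_gf T M Y p q =
     (\<Sum>C\<in>configurations T M Y. p ^ card (chain_pairs (>) T C) * q ^ card (chain_pairs (<) T C))"

lemma rows_remove_row: "rows (remove_row T x) = rows T - {x}"
  by (force simp: rows_def remove_row_def)

lemma row_columns_remove_row: "x' \<noteq> x \<Longrightarrow> row_columns (remove_row T x) x' = row_columns T x'"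
  by (simp add: row_columns_def remove_row_def)

text \<open>A configuration splits into the columns \<open>S\<close> of its ones in row
  \<open>x\<close> and the rest. As columns hold at most one cell of it, the rest occupies exactly
  the columns \<open>Y - S\<close>.\<close>

lemma bij_betw_configurations:
  assumes "x \<in> rows T"
  shows "bij_betw (\<lambda>(S, C). Pair x ` S \<union> C)
     (SIGMA S:{S. S \<subseteq> Y \<inter> row_columns T x \<and> int (card S) = M x}.
        configurations (remove_row T x) M (Y - S))
     (configurations T M Y)"
proof (rule bij_betw_byWitness[where f' = "\<lambda>C. (row_columns C x, remove_row C x)"])
  let ?D = "SIGMA S:{S. S \<subseteq> Y \<inter> row_columns T x \<and> int (card S) = M x}.
    configurations (remove_row T x) M (Y - S)"
  have sub: "C \<subseteq> remove_row T x" if "C \<in> configurations (remove_row T x) M Z" for C Z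
    using that by (simp add: configurations_def)
  have rc: "row_columns (Pair x ` S \<union> C) x' = (if x' = x then S else row_columns C x')"
    if "C \<subseteq> remove_row T x" for S C x'
    using that by (auto simp: row_columns_def remove_row_def)
  show "\<forall>a\<in>?D. (\<lambda>C. (row_columns C x, remove_row C x)) ((\<lambda>(S, C). Pair x ` S \<union> C) a) = a"
    by (auto dest!: sub) (auto simp: row_columns_def remove_row_def)
  show "\<forall>C\<in>configurations T M Y.
      (\<lambda>(S, C). Pair x ` S \<union> C) (row_columns C x, remove_row C x) = C"
    by (force simp: row_columns_def remove_row_def)
  show "(\<lambda>(S, C). Pair x ` S \<union> C) ` ?D \<subseteq> configurations T M Y"
  proof clarify
    fix S C assume S: "S \<subseteq> Y \<inter> row_columns T x" "int (card S) = M x"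
      and C: "C \<in> configurations (remove_row T x) M (Y - S)"
    have "Pair x ` S \<union> C \<subseteq> T"
      using S sub[OF C] by (auto simp: row_columns_def remove_row_def)
    moreover have "\<forall>x'\<in>rows T. int (card (row_columns (Pair x ` S \<union> C) x')) = M x'"
      using S C rc[OF sub[OF C]] by (auto simp: configurations_def rows_remove_row)
    moreover have "inj_on snd (Pair x ` S \<union> C)"
    proof -
      have "snd ` C \<inter> S = {}" "inj_on snd C"
        using C by (auto simp: configurations_def)
      moreover have "inj_on snd (Pair x ` S)"
        by (auto simp: inj_on_def)
      moreover have "snd ` (Pair x ` S - C) \<subseteq> S"
        by auto
      ultimately show ?thesis
        unfolding inj_on_Un by blast
    qed
    moreover have "snd ` (Pair x ` S \<union> C) = Y"
      using C S by (auto simp: configurations_def image_Un image_image)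
    ultimately show "Pair x ` S \<union> C \<in> configurations T M Y"
      by (simp add: configurations_def)
  qed
  show "(\<lambda>C. (row_columns C x, remove_row C x)) ` configurations T M Y \<subseteq> ?D"
  proof clarify
    fix C assume C: "C \<in> configurations T M Y"
    then have sub: "C \<subseteq> T" and inj: "inj_on snd C" and Y: "Y = snd ` C"
      by (auto simp: configurations_def)
    have "row_columns C x \<subseteq> Y \<inter> row_columns T x"
      using sub Y by (force simp: row_columns_def)
    moreover have "int (card (row_columns C x)) = M x"
      using C assms by (simp add: configurations_def)
    moreover have "remove_row C x \<in> configurations (remove_row T x) M (Y - row_columns C x)"
    proof -
      have "remove_row C x \<subseteq> remove_row T x"
        using sub by (auto simp: remove_row_def)
      moreover have "\<forall>x'\<in>rows (remove_row T x). int (card (row_columns (remove_row C x) x')) = M x'"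
        using C by (auto simp: configurations_def rows_remove_row row_columns_remove_row)
      moreover have "inj_on snd (remove_row C x)"
        using inj by (auto simp: remove_row_def inj_on_def)
      moreover have "snd ` remove_row C x = Y - row_columns C x"
        unfolding Y remove_row_def row_columns_def using inj by (force simp: inj_on_def)
      ultimately show ?thesis by (simp add: configurations_def)
    qed
    ultimately show "row_columns C x \<in> {S. S \<subseteq> Y \<inter> row_columns T x \<and> int (card S) = M x} \<and>
      remove_row C x \<in> configurations (remove_row T x) M (Y - row_columns C x)" by blast
  qed
qed

section \<open>Ascents and descents involving an extreme row\<close>

lemma bounding_rectangle_commute: "bounding_rectangle c d = bounding_rectangle d c"
  by (simp add: bounding_rectangle_def min.commute max.commute)

lemma row_convex:
  assumes "moon_polyomino T" "(x, y) \<in> T" "(x, y') \<in> T" "min y y' \<le> z" "z \<le> max y y'"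
  shows "(x, z) \<in> T"
proof -
  have "(x, z) \<in> T" if "(x, y) \<in> T" "(x, y') \<in> T" "y \<le> z" "z \<le> y'" for y y'
    using assms(1) that unfolding moon_polyomino_def convex_polyomino_def by blast
  from this[of y y'] this[of y' y] show ?thesis
    using assms(2-) by linarith
qed

lemma column_convex:
  assumes "moon_polyomino T" "(x, y) \<in> T" "(x', y) \<in> T" "min x x' \<le> z" "z \<le> max x x'"
  shows "(z, y) \<in> T"
proof -
  have "(z, y) \<in> T" if "(x, y) \<in> T" "(x', y) \<in> T" "x \<le> z" "z \<le> x'" for x x'
    using assms(1) that unfolding moon_polyomino_def convex_polyomino_def by blast
  from this[of x x'] this[of x' x] show ?thesis
    using assms(2-) by linarith
qed

text \<open>Only the corner \<open>(x, u)\<close> matters: if it lies in \<open>T\<close>, row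
  convexity fills the side in row \<open>x\<close>, the inclusion of rows copies this side to row
  \<open>x'\<close>, and column convexity fills the space between.\<close>

lemma bounding_rectangle_subset_iff:
  assumes "moon_polyomino T" "(x, s) \<in> T" "(x', u) \<in> T"
    and "row_columns T x \<subseteq> row_columns T x'"
  shows "bounding_rectangle (x, s) (x', u) \<subseteq> T \<longleftrightarrow> u \<in> row_columns T x"
proof
  assume "bounding_rectangle (x, s) (x', u) \<subseteq> T"
  moreover have "(x, u) \<in> bounding_rectangle (x, s) (x', u)"
    by (simp add: bounding_rectangle_def)
  ultimately show "u \<in> row_columns T x"
    by (auto simp: row_columns_def)
next
  assume u: "u \<in> row_columns T x"
  show "bounding_rectangle (x, s) (x', u) \<subseteq> T"
  proof
    fix c assume c: "c \<in> bounding_rectangle (x, s) (x', u)"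
    obtain x0 y0 where [simp]: "c = (x0, y0)" by (cases c)
    have "(x, y0) \<in> T"
      using row_convex[OF assms(1,2), of u y0] u c by (simp add: row_columns_def bounding_rectangle_def)
    moreover from this have "(x', y0) \<in> T"
      using assms(4) by (auto simp: row_columns_def)
    ultimately show "c \<in> T"
      using column_convex[OF assms(1), of x y0 x' x0] c by (simp add: bounding_rectangle_def)
  qed
qed

text \<open>No rectangle spanned by two cells on the same side of row \<open>x\<close> meets that
  row, so removing it does not affect which of these rectangles are contained in the
  polyomino.\<close>

lemma chain_pairs_remove_row:
  assumes "C \<subseteq> remove_row T x"
    and "(\<forall>x'\<in>rows T - {x}. x < x') \<or> (\<forall>x'\<in>rows T - {x}. x' < x)"
  shows "chain_pairs R (remove_row T x) C = {(c, d) \<in> chain_pairs R T C. fst c \<noteq> x \<and> fst d \<noteq> x}"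
proof -
  have "bounding_rectangle c d \<subseteq> remove_row T x"
    if "c \<in> C" "d \<in> C" "bounding_rectangle c d \<subseteq> T" for c d
  proof -
    have "fst c \<in> rows T - {x}" "fst d \<in> rows T - {x}"
      using that assms(1) by (auto simp: remove_row_def rows_def)
    then have "x < fst c \<and> x < fst d \<or> fst c < x \<and> fst d < x"
      using assms(2) by blast
    then have "x \<notin> {min (fst c) (fst d)..max (fst c) (fst d)}"
      by auto
    then show ?thesis
      using that by (auto simp: remove_row_def bounding_rectangle_def)
  qed
  then have "bounding_rectangle c d \<subseteq> remove_row T x \<longleftrightarrow> bounding_rectangle c d \<subseteq> T"
    if "c \<in> C" "d \<in> C" for c d
    using that unfolding remove_row_def by blast
  moreover have "fst c \<noteq> x" if "c \<in> C" for c
    using assms(1) that by (auto simp: remove_row_def)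
  ultimately have "(c, d) \<in> chain_pairs R (remove_row T x) C \<longleftrightarrow>
      (c, d) \<in> chain_pairs R T C \<and> fst c \<noteq> x \<and> fst d \<noteq> x" for c d
    by (cases "c \<in> C \<and> d \<in> C") (auto simp: chain_pairs_def)
  then show ?thesis by auto
qed

text \<open>The new pairs have exactly one cell in row \<open>x\<close>, since \<open>R\<close> is
  irreflexive there. The first claim treats the case where \<open>R\<close> forces this cell to be
  the left one, the second the case where it is the right one. Both occur for a top row as well as
  for a bottom row, with \<open>R\<close> being \<open>(<)\<close> or \<open>(>)\<close>.\<close>

lemma card_chain_pairs_union:
  assumes moon: "moon_polyomino T"
    and min: "\<And>x'. x' \<in> rows T \<Longrightarrow> row_columns T x \<subseteq> row_columns T x'"
    and extreme: "(\<forall>x'\<in>rows T - {x}. x < x') \<or> (\<forall>x'\<in>rows T - {x}. x' < x)"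
    and S: "S \<subseteq> Y \<inter> row_columns T x"
    and C: "C \<in> configurations (remove_row T x) M (Y - S)"
    and irrefl: "\<not> R x x"
  shows "(\<And>x'. x' \<in> rows T - {x} \<Longrightarrow> R x x' \<and> \<not> R x' x) \<Longrightarrow>
      card (chain_pairs R T (Pair x ` S \<union> C)) =
      pairs_lt (Y \<inter> row_columns T x) S + card (chain_pairs R (remove_row T x) C)"
    and "(\<And>x'. x' \<in> rows T - {x} \<Longrightarrow> R x' x \<and> \<not> R x x') \<Longrightarrow>
      card (chain_pairs R T (Pair x ` S \<union> C)) =
      pairs_gt (Y \<inter> row_columns T x) S + card (chain_pairs R (remove_row T x) C)"
proof -
  let ?X = "Y \<inter> row_columns T x"
  have sub: "C \<subseteq> remove_row T x" and inj: "inj_on snd C" and Y: "snd ` C = Y - S"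
    using C by (auto simp: configurations_def)
  have CT: "d \<in> T" "fst d \<in> rows T - {x}" if "d \<in> C" for d
    using that sub by (auto simp: remove_row_def rows_def)
  have ST: "(x, s) \<in> T" if "s \<in> S" for s
    using that S by (auto simp: row_columns_def)
  have finT: "finite T"
    using moon by (simp add: moon_polyomino_def convex_polyomino_def polyomino_def)
  have fin: "finite (Pair x ` S)" "finite C"
    using finite_subset[OF _ finT] ST CT by blast+
  have rect: "bounding_rectangle (x, s) d \<subseteq> T \<longleftrightarrow> snd d \<in> ?X"
    if "s \<in> S" "d \<in> C" for s d
  proof -
    have "snd d \<in> Y" using Y that by blast
    then show ?thesis
      using bounding_rectangle_subset_iff[OF moon ST[OF that(1)], of "fst d" "snd d"] min CT[OF that(2)]
      by simp
  qed
  have fin_chain: "finite (chain_pairs R (remove_row T x) C)"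
    by (rule finite_subset[of _ "C \<times> C"]) (auto simp: chain_pairs_def fin)
  note old = chain_pairs_remove_row[OF sub extreme]
  show "card (chain_pairs R T (Pair x ` S \<union> C)) =
      pairs_lt ?X S + card (chain_pairs R (remove_row T x) C)"
    if R: "\<And>x'. x' \<in> rows T - {x} \<Longrightarrow> R x x' \<and> \<not> R x' x"
  proof -
    \<comment> \<open>These are the new pairs. Each column in \<open>Y - S\<close> holds exactly one
      cell of \<open>C\<close>, so a pair is determined by its two columns.\<close>
    let ?Q = "{(c, d). c \<in> Pair x ` S \<and> d \<in> C \<and> snd d \<in> ?X \<and> snd c < snd d}"
    have "chain_pairs R T (Pair x ` S \<union> C) = ?Q \<union> chain_pairs R (remove_row T x) C"
      unfolding old unfolding chain_pairs_def using R CT irrefl rect by fastforce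
    moreover have "?Q \<inter> chain_pairs R (remove_row T x) C = {}"
      unfolding old by auto
    moreover have "finite ?Q"
      by (rule finite_subset[of _ "Pair x ` S \<times> C"]) (auto simp: fin)
    moreover have "bij_betw (map_prod snd snd) ?Q {(s, u). s \<in> S \<and> u \<in> ?X - S \<and> s < u}"
    proof (rule bij_betw_imageI)
      show "inj_on (map_prod snd snd) ?Q"
        using inj by (auto simp: inj_on_def)
      show "map_prod snd snd ` ?Q = {(s, u). s \<in> S \<and> u \<in> ?X - S \<and> s < u}" (is "_ = ?P")
      proof
        show "map_prod snd snd ` ?Q \<subseteq> ?P" using Y by auto
        show "?P \<subseteq> map_prod snd snd ` ?Q"
        proof clarify
          fix s u assume *: "s \<in> S" "u \<in> Y" "u \<in> row_columns T x" "u \<notin> S" "s < u"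
          then obtain d where "d \<in> C" "snd d = u" using Y by (metis DiffI imageE)
          then show "(s, u) \<in> map_prod snd snd ` ?Q"
            using * by (intro image_eqI[of _ _ "((x, s), d)"]) auto
        qed
      qed
    qed
    ultimately show ?thesis
      using fin_chain by (simp add: card_Un_disjoint pairs_lt_def bij_betw_same_card)
  qed
  show "card (chain_pairs R T (Pair x ` S \<union> C)) =
      pairs_gt ?X S + card (chain_pairs R (remove_row T x) C)"
    if R: "\<And>x'. x' \<in> rows T - {x} \<Longrightarrow> R x' x \<and> \<not> R x x'"
  proof -
    \<comment> \<open>Now the cell in row \<open>x\<close> comes second, so the projection to
      \<open>(s, u)\<close> below exchanges the components.\<close>
    let ?Q = "{(d, c). c \<in> Pair x ` S \<and> d \<in> C \<and> snd d \<in> ?X \<and> snd d < snd c}"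
    have rect': "bounding_rectangle d (x, s) \<subseteq> T \<longleftrightarrow> snd d \<in> ?X" if "s \<in> S" "d \<in> C" for s d
      using rect[OF that] by (simp only: bounding_rectangle_commute)
    have RC: "R (fst d) x" "\<not> R x (fst d)" "fst d \<noteq> x" if "d \<in> C" for d
      using R CT(2)[OF that] by auto
    have "(d, c) \<in> chain_pairs R T (Pair x ` S \<union> C) \<longleftrightarrow>
        (d, c) \<in> ?Q \<union> chain_pairs R (remove_row T x) C" for d c
      unfolding old by (cases "d \<in> C"; cases "c \<in> C")
        (auto simp: chain_pairs_def rect' irrefl RC dest: RC(3) del: subsetI)
    then have "chain_pairs R T (Pair x ` S \<union> C) = ?Q \<union> chain_pairs R (remove_row T x) C"
      by auto
    moreover have "?Q \<inter> chain_pairs R (remove_row T x) C = {}"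
      unfolding old by auto
    moreover have "finite ?Q"
      by (rule finite_subset[of _ "C \<times> Pair x ` S"]) (auto simp: fin)
    moreover have "bij_betw (\<lambda>(d, c). (snd c, snd d)) ?Q {(s, u). s \<in> S \<and> u \<in> ?X - S \<and> u < s}"
    proof (rule bij_betw_imageI)
      show "inj_on (\<lambda>(d, c). (snd c, snd d)) ?Q"
        using inj by (auto simp: inj_on_def)
      show "(\<lambda>(d, c). (snd c, snd d)) ` ?Q = {(s, u). s \<in> S \<and> u \<in> ?X - S \<and> u < s}" (is "_ = ?P")
      proof
        show "(\<lambda>(d, c). (snd c, snd d)) ` ?Q \<subseteq> ?P" using Y by auto
        show "?P \<subseteq> (\<lambda>(d, c). (snd c, snd d)) ` ?Q"
        proof clarify
          fix s u assume *: "s \<in> S" "u \<in> Y" "u \<in> row_columns T x" "u \<notin> S" "u < s"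
          then obtain d where "d \<in> C" "snd d = u" using Y by (metis DiffI imageE)
          then show "(s, u) \<in> (\<lambda>(d, c). (snd c, snd d)) ` ?Q"
            using * by (intro image_eqI[of _ _ "(d, (x, s))"]) auto
        qed
      qed
    qed
    ultimately show ?thesis
      using fin_chain by (simp add: card_Un_disjoint pairs_gt_def bij_betw_same_card)
  qed
qed

text \<open>For a top row, ascents are counted by \<open>pairs_gt\<close> and descents by
  \<open>pairs_lt\<close>; for a bottom row it is the other way round, whence the exchange governed
  by \<open>upper\<close>. By \<open>const\<close> the contribution of the other rows can be
  factored out; if no \<open>S\<close> is admissible, \<open>g\<close> is arbitrary.\<close>

lemma configuration_gf_remove_row:
  fixes p q :: "'a::comm_semiring_1"
  assumes moon: "moon_polyomino T" and x: "x \<in> rows T"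
    and min: "\<And>x'. x' \<in> rows T \<Longrightarrow> row_columns T x \<subseteq> row_columns T x'"
    and extreme: "if upper then \<forall>x'\<in>rows T - {x}. x < x' else \<forall>x'\<in>rows T - {x}. x' < x"
    and const: "\<And>S. S \<subseteq> Y \<inter> row_columns T x \<Longrightarrow> int (card S) = M x \<Longrightarrow>
      configuration_gf (remove_row T x) M (Y - S) p q = g"
  shows "configuration_gf T M Y p q =
    subset_gf (Y \<inter> row_columns T x) (M x) (if upper then p else q) (if upper then q else p) * g"
proof -
  let ?X = "Y \<inter> row_columns T x" and ?T' = "remove_row T x"
  let ?w = "\<lambda>T C. p ^ card (chain_pairs (>) T C) * q ^ card (chain_pairs (<) T C)"
  let ?p = "if upper then p else q" and ?q = "if upper then q else p"
  have finT: "finite T"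
    using moon by (simp add: moon_polyomino_def convex_polyomino_def polyomino_def)
  have "finite (row_columns T x)"
    using finite_imageI[OF finT, of snd] by (rule finite_subset[rotated]) (force simp: row_columns_def)
  then have finX: "finite {S. S \<subseteq> ?X \<and> int (card S) = M x}"
    by simp
  have finC: "finite (configurations ?T' M Z)" for Z
    by (rule finite_subset[of _ "Pow T"]) (auto simp: configurations_def remove_row_def finT)
  have weight: "?w T (Pair x ` S \<union> C) = ?p ^ pairs_gt ?X S * ?q ^ pairs_lt ?X S * ?w ?T' C"
    if "S \<subseteq> ?X" "C \<in> configurations ?T' M (Y - S)" for S C
  proof (cases upper)
    case True
    then have *: "\<forall>x'\<in>rows T - {x}. x < x'"
      using extreme by simp
    show ?thesis
      using card_chain_pairs_union(2)[OF moon min disjI1[OF *] that, of "(>)"]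
        card_chain_pairs_union(1)[OF moon min disjI1[OF *] that, of "(<)"] * True
      by (simp add: power_add less_imp_le linorder_not_less mult_ac)
  next
    case False
    then have *: "\<forall>x'\<in>rows T - {x}. x' < x"
      using extreme by simp
    show ?thesis
      using card_chain_pairs_union(1)[OF moon min disjI2[OF *] that, of "(>)"]
        card_chain_pairs_union(2)[OF moon min disjI2[OF *] that, of "(<)"] * False
      by (simp add: power_add less_imp_le linorder_not_less mult_ac)
  qed
  have "configuration_gf T M Y p q =
      (\<Sum>(S, C)\<in>(SIGMA S:{S. S \<subseteq> ?X \<and> int (card S) = M x}. configurations ?T' M (Y - S)).
        ?w T (Pair x ` S \<union> C))"
    unfolding configuration_gf_def
    by (subst sum.reindex_bij_betw[OF bij_betw_configurations[OF x], symmetric])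
      (simp add: split_beta)
  also have "\<dots> = (\<Sum>S | S \<subseteq> ?X \<and> int (card S) = M x. \<Sum>C\<in>configurations ?T' M (Y - S).
      ?w T (Pair x ` S \<union> C))"
    using finX finC by (subst sum.Sigma) auto
  also have "\<dots> = (\<Sum>S | S \<subseteq> ?X \<and> int (card S) = M x.
      ?p ^ pairs_gt ?X S * ?q ^ pairs_lt ?X S * configuration_gf ?T' M (Y - S) p q)"
    unfolding configuration_gf_def sum_distrib_left by (intro sum.cong refl weight) auto
  also have "\<dots> = subset_gf ?X (M x) ?p ?q * g"
    unfolding subset_gf_def sum_distrib_right by (intro sum.cong refl) (simp add: const)
  finally show ?thesis .
qed

section \<open>Extreme rows and induction on the number of rows\<close>

lemma finite_rows: "moon_polyomino T \<Longrightarrow> finite (rows T)"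
  by (simp add: moon_polyomino_def convex_polyomino_def polyomino_def rows_def)

lemma row_columns_chain:
  "moon_polyomino T \<Longrightarrow> x \<in> rows T \<Longrightarrow> x' \<in> rows T \<Longrightarrow>
    row_columns T x \<subseteq> row_columns T x' \<or> row_columns T x' \<subseteq> row_columns T x"
  by (auto simp: moon_polyomino_def intersection_free_def row_columns_def)

text \<open>By column convexity, a column that meets both the top and the bottom row meets every
  row. These two rows are comparable, so their intersection is one of them.\<close>

lemma ex_extreme_row:
  assumes moon: "moon_polyomino T"
  obtains x upper where "x \<in> rows T" "\<And>x'. x' \<in> rows T \<Longrightarrow> row_columns T x \<subseteq> row_columns T x'"
    "if upper then \<forall>x'\<in>rows T - {x}. x < x' else \<forall>x'\<in>rows T - {x}. x' < x"
proof -
  let ?a = "Min (rows T)" and ?b = "Max (rows T)"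
  note fin = finite_rows[OF moon]
  have ne: "rows T \<noteq> {}"
    using moon by (simp add: moon_polyomino_def convex_polyomino_def polyomino_def rows_def)
  have ab: "?a \<in> rows T" "?b \<in> rows T"
    using fin ne by auto
  have between: "row_columns T ?a \<inter> row_columns T ?b \<subseteq> row_columns T x" if "x \<in> rows T" for x
    using column_convex[OF moon, of ?a _ ?b x] Min_le[OF fin that] Max_ge[OF fin that]
    by (auto simp: row_columns_def min.coboundedI1 max.coboundedI2)
  have "?a < x" if "x \<in> rows T - {?a}" for x
    using fin that by (metis DiffE Min_le insertI1 order_le_imp_less_or_eq)
  moreover have "x < ?b" if "x \<in> rows T - {?b}" for x
    using fin that by (metis DiffE Max_ge insertI1 order_le_imp_less_or_eq)
  ultimately show ?thesis
    using that[of ?a True] that[of ?b False] row_columns_chain[OF moon ab] between ab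
    by (metis inf.absorb1 inf.absorb2)
qed

text \<open>Column convexity is the only delicate point: since row \<open>x\<close> is extreme, no
  cell of it lies between two remaining cells of a column.\<close>

lemma moon_polyomino_remove_row:
  assumes moon: "moon_polyomino T" and ne: "remove_row T x \<noteq> {}"
    and extreme: "(\<forall>x'\<in>rows T - {x}. x < x') \<or> (\<forall>x'\<in>rows T - {x}. x' < x)"
  shows "moon_polyomino (remove_row T x)"
proof -
  have "finite (remove_row T x)"
    using moon by (simp add: moon_polyomino_def convex_polyomino_def polyomino_def remove_row_def)
  moreover have "(x', z) \<in> remove_row T x"
    if "(x', y) \<in> remove_row T x" "(x', y') \<in> remove_row T x" "y \<le> z" "z \<le> y'" for x' y y' z
    using that row_convex[OF moon, of x' y y' z] by (simp add: remove_row_def)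
  moreover have "(z, y) \<in> remove_row T x"
    if "(x', y) \<in> remove_row T x" "(x'', y) \<in> remove_row T x" "x' \<le> z" "z \<le> x''" for x' x'' y z
  proof -
    have "x' \<in> rows T - {x}" "x'' \<in> rows T - {x}"
      using that by (force simp: remove_row_def rows_def)+
    then have "x < x' \<and> x < x'' \<or> x' < x \<and> x'' < x"
      using extreme by blast
    then have "z \<noteq> x"
      using that by auto
    then show ?thesis
      using that column_convex[OF moon, of x' y x'' z] by (simp add: remove_row_def)
  qed
  moreover have "intersection_free (remove_row T x)"
    unfolding intersection_free_def
  proof (intro ballI)
    fix x1 x2 assume "x1 \<in> rows (remove_row T x)" "x2 \<in> rows (remove_row T x)"
    then show "{y. (x1, y) \<in> remove_row T x} \<subseteq> {y. (x2, y) \<in> remove_row T x} \<or>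
        {y. (x2, y) \<in> remove_row T x} \<subseteq> {y. (x1, y) \<in> remove_row T x}"
      using row_columns_chain[OF moon, of x1 x2]
      by (simp add: rows_remove_row) (auto simp: remove_row_def row_columns_def)
  qed
  ultimately show ?thesis
    unfolding moon_polyomino_def convex_polyomino_def polyomino_def using ne by blast
qed

text \<open>Admitting two column sets makes the induction hypothesis applicable to \<open>Y - S\<close> and \<open>Y' - S'\<close>
  for any two choices \<open>S\<close> and \<open>S'\<close> of the ones in the removed row.\<close>

lemma configuration_gf_swap:
  assumes "T = {} \<or> moon_polyomino T" "finite Y" "finite Y'" "card Y = card Y'"
    and "\<And>x. x \<in> rows T \<Longrightarrow> card (Y \<inter> row_columns T x) = card (Y' \<inter> row_columns T x)"
  shows "configuration_gf T M Y p q = configuration_gf T M Y' q p"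
  using assms
proof (induction "card (rows T)" arbitrary: T Y Y' p q rule: less_induct)
  case less
  show ?case
  \<comment> \<open>Removing the last row leaves the empty set, which is not a polyomino and forms
    the base case. Its only configuration is the empty one, which requires
    \<open>Y = {}\<close>.\<close>
  proof (cases "T = {}")
    case True
    then have "configurations T M Z = (if Z = {} then {{}} else {})" for Z
      by (auto simp: configurations_def rows_def)
    moreover have "Y = {} \<longleftrightarrow> Y' = {}"
      using less.prems by (metis card_0_eq)
    ultimately show ?thesis
      by (simp add: configuration_gf_def chain_pairs_def)
  next
    case False
    with less.prems have moon: "moon_polyomino T" by simp
    obtain x upper where x: "x \<in> rows T"
      and min: "\<And>x'. x' \<in> rows T \<Longrightarrow> row_columns T x \<subseteq> row_columns T x'"
      and extreme: "if upper then \<forall>x'\<in>rows T - {x}. x < x' else \<forall>x'\<in>rows T - {x}. x' < x"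
      using ex_extreme_row[OF moon] by blast
    let ?T' = "remove_row T x" and ?I = "row_columns T x"
    have moon': "?T' = {} \<or> moon_polyomino ?T'"
      using moon_polyomino_remove_row[OF moon] extreme by (cases upper) auto
    have less': "card (rows ?T') < card (rows T)"
      unfolding rows_remove_row using finite_rows[OF moon] x by (rule card_Diff1_less)
    \<comment> \<open>All of \<open>S\<close> lies in every row's column set by minimality of row
      \<open>x\<close>, so each count drops by the same number \<open>M x\<close>, whichever
      \<open>S\<close> is chosen.\<close>
    have card_diff: "card ((Z - S) \<inter> row_columns T x') = card (Z \<inter> row_columns T x') - nat (M x)"
      "card (Z - S) = card Z - nat (M x)"
      if "finite Z" "S \<subseteq> Z \<inter> ?I" "int (card S) = M x" "x' \<in> rows T" for Z S x'
    proof -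
      have "(Z - S) \<inter> row_columns T x' = Z \<inter> row_columns T x' - S" by blast
      moreover have "S \<subseteq> Z \<inter> row_columns T x'" using that min by blast
      moreover have "finite S" using that by (meson finite_Int finite_subset)
      ultimately show "card ((Z - S) \<inter> row_columns T x') = card (Z \<inter> row_columns T x') - nat (M x)"
        "card (Z - S) = card Z - nat (M x)"
        using that by (auto simp: card_Diff_subset simp flip: that(3))
    qed
    have IH: "configuration_gf ?T' M (Y - S) p q = configuration_gf ?T' M (Y' - S') q p"
      if S: "S \<subseteq> Y \<inter> ?I" "int (card S) = M x" and S': "S' \<subseteq> Y' \<inter> ?I" "int (card S') = M x"
      for S S'
    proof (rule less.hyps[OF less' moon'])
      show "finite (Y - S)" "finite (Y' - S')" using less.prems by auto
      show "card (Y - S) = card (Y' - S')"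
        using card_diff(2)[OF _ S x] card_diff(2)[OF _ S' x] less.prems by simp
      show "card ((Y - S) \<inter> row_columns ?T' x') = card ((Y' - S') \<inter> row_columns ?T' x')"
        if "x' \<in> rows ?T'" for x'
        using that card_diff(1)[OF _ S, of x'] card_diff(1)[OF _ S', of x'] less.prems
        by (simp add: rows_remove_row row_columns_remove_row)
    qed
    have card_X: "card (Y \<inter> ?I) = card (Y' \<inter> ?I)"
      using less.prems x by blast
    have fin_X: "finite (Y \<inter> ?I)" "finite (Y' \<inter> ?I)"
      using less.prems by auto
    show ?thesis
    proof (cases "\<exists>S. S \<subseteq> Y \<inter> ?I \<and> int (card S) = M x")
      case True
      then obtain S0 where S0: "S0 \<subseteq> Y \<inter> ?I" "int (card S0) = M x" by blast
      then obtain S1 where S1: "S1 \<subseteq> Y' \<inter> ?I" "int (card S1) = M x"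
        using card_X card_mono[OF fin_X(1) S0(1)] by (metis obtain_subset_with_card_n)
      \<comment> \<open>This is the common factor for all choices. For \<open>Y'\<close> the
        induction hypothesis compares with \<open>S0\<close> directly; for \<open>Y\<close> it is
        used twice, passing through \<open>S1\<close>, so that the two exchanges of \<open>p\<close>
        and \<open>q\<close> cancel.\<close>
      let ?g = "configuration_gf ?T' M (Y - S0) p q"
      have "configuration_gf T M Y p q =
          subset_gf (Y \<inter> ?I) (M x) (if upper then p else q) (if upper then q else p) * ?g"
        using IH S0 S1 by (intro configuration_gf_remove_row[OF moon x min extreme]) metis+
      moreover have "configuration_gf T M Y' q p =
          subset_gf (Y' \<inter> ?I) (M x) (if upper then q else p) (if upper then p else q) * ?g"
        using IH S0 by (intro configuration_gf_remove_row[OF moon x min extreme]) metis+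
      ultimately show ?thesis
        using subset_gf_swap[OF fin_X card_X] by metis
    next
      case False
      moreover from this have "\<not> (\<exists>S. S \<subseteq> Y' \<inter> ?I \<and> int (card S) = M x)"
        using card_X card_mono[OF fin_X(2)] by (metis obtain_subset_with_card_n)
      \<comment> \<open>With no admissible set, the constancy condition is vacuous and the common
        factor may be taken to be 0.\<close>
      ultimately have "configuration_gf T M Y p q = 0" "configuration_gf T M Y' q p = 0"
        using configuration_gf_remove_row[OF moon x min extreme, of Y M p q 0]
          configuration_gf_remove_row[OF moon x min extreme, of Y' M q p 0] by auto
      then show ?thesis by simp
    qed
  qed
qed

section \<open>From fillings to configurations\<close>

lemma card_unordered_chain_pairs:
  "card {{c, d} | c d. c \<in> C \<and> d \<in> C \<and> R (fst c) (fst d) \<and> snd c < snd d \<and>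
     bounding_rectangle c d \<subseteq> T} = card (chain_pairs R T C)" (is "card ?U = _")
proof -
  have "(\<lambda>(c, d). {c, d}) ` chain_pairs R T C = ?U"
  proof (intro equalityI subsetI)
    fix P assume "P \<in> (\<lambda>(c, d). {c, d}) ` chain_pairs R T C"
    then obtain c d where "P = {c, d}" "(c, d) \<in> chain_pairs R T C" by auto
    then show "P \<in> ?U" unfolding chain_pairs_def by blast
  next
    fix P assume "P \<in> ?U"
    then obtain c d where "P = {c, d}" "(c, d) \<in> chain_pairs R T C"
      unfolding chain_pairs_def by blast
    then show "P \<in> (\<lambda>(c, d). {c, d}) ` chain_pairs R T C" by force
  qed
  \<comment> \<open>An unordered pair determines the ordered one, because the column coordinates
    tell which cell is the left one.\<close>
  moreover have "card ((\<lambda>(c, d). {c, d}) ` chain_pairs R T C) = card (chain_pairs R T C)"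
  proof (rule card_image, rule inj_onI)
    fix a b assume a: "a \<in> chain_pairs R T C" and b: "b \<in> chain_pairs R T C"
      and eq: "(\<lambda>(c, d). {c, d}) a = (\<lambda>(c, d). {c, d}) b"
    have "snd (fst a) < snd (snd a)" "snd (fst b) < snd (snd b)"
      using a b by (simp_all add: chain_pairs_def split_beta)
    moreover have "{fst a, snd a} = {fst b, snd b}"
      using eq by (simp only: split_beta)
    ultimately show "a = b"
      unfolding doubleton_eq_iff by (intro prod_eqI[of a b]) auto
  qed
  ultimately show ?thesis
    by (simp only:)
qed

lemma ne2_eq_card_chain_pairs: "ne2 T F = card (chain_pairs (>) T (ones T F))"
  unfolding ne2_def ascents_def by (rule card_unordered_chain_pairs)

lemma se2_eq_card_chain_pairs: "se2 T F = card (chain_pairs (<) T (ones T F))"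
  unfolding se2_def descents_def by (rule card_unordered_chain_pairs)

lemma bij_betw_ones: "bij_betw (ones T) (fillings T) (Pow T)"
proof (rule bij_betw_byWitness[where f' = "\<lambda>C. restrict (\<lambda>c. if c \<in> C then 1 else 0) T"])
  show "\<forall>F\<in>fillings T. restrict (\<lambda>c. if c \<in> ones T F then 1 else 0) T = F"
  proof
    fix F assume F: "F \<in> fillings T"
    show "restrict (\<lambda>c. if c \<in> ones T F then 1 else 0) T = F"
    proof
      fix c
      show "restrict (\<lambda>c. if c \<in> ones T F then 1 else 0) T c = F c"
        using F PiE_mem[of F T "\<lambda>_. {0, 1}" c] PiE_arb[of F T "\<lambda>_. {0, 1}" c]
        by (auto simp: fillings_def ones_def)
    qed
  qed
qed (auto simp: fillings_def ones_def split: if_splits)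

text \<open>Labels are translated to coordinates through their bijections with rows and columns. The
  bound on \<open>A\<close> ensures that the set of nonempty columns determines
  \<open>A\<close>.\<close>

lemma N_fillings_EC_iff:
  assumes fin: "finite T" and A: "A \<subseteq> {1..num_columns T}"
  shows "F \<in> N_fillings_EC T m A \<longleftrightarrow> F \<in> fillings T \<and> ones T F \<in>
    configurations T (\<lambda>x. m (row_label T x)) {y \<in> columns T. column_label T y \<notin> A}"
proof (cases "F \<in> fillings T")
  case True
  let ?C = "ones T F"
  have sub: "?C \<subseteq> T" by (auto simp: ones_def)
  have finC: "finite ?C" using sub fin by (rule finite_subset)
  have row: "inj_on (row_label T) (rows T)" "row_label T ` rows T = {1..num_rows T}"
    and col: "inj_on (column_label T) (columns T)" "column_label T ` columns T = {1..num_columns T}"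
    using row_label_bij_betw[OF fin] column_label_bij_betw[OF fin] by (auto simp: bij_betw_def)
  have in_rows: "fst c \<in> rows T" "snd c \<in> columns T" if "c \<in> T" for c
    using that by (auto simp: rows_def columns_def)
  have "row_count T F (row_label T x) = card (row_columns ?C x)" if "x \<in> rows T" for x
  proof -
    have "{c \<in> ?C. row_label T (fst c) = row_label T x} = Pair x ` row_columns ?C x"
      using inj_on_eq_iff[OF row(1) in_rows(1) that] sub by (force simp: row_columns_def)
    then show ?thesis
      by (simp add: row_count_def card_image inj_on_def)
  qed
  then have "(\<forall>i\<in>{1..num_rows T}. int (row_count T F i) = m i) \<longleftrightarrow>
      (\<forall>x\<in>rows T. int (card (row_columns ?C x)) = m (row_label T x))"
    unfolding row(2)[symmetric] by simp
  moreover have "(\<forall>j\<in>{1..num_columns T}. column_count T F j \<le> 1) \<longleftrightarrow> inj_on snd ?C"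
  proof -
    have "column_count T F (column_label T y) = card {c \<in> ?C. snd c = y}" if "y \<in> columns T" for y
      unfolding column_count_def
      using col(1) that in_rows sub by (intro arg_cong[of _ _ card]) (auto simp: inj_on_def)
    then have "(\<forall>j\<in>{1..num_columns T}. column_count T F j \<le> 1) \<longleftrightarrow>
        (\<forall>y\<in>columns T. card {c \<in> ?C. snd c = y} \<le> Suc 0)"
      unfolding col(2)[symmetric] by simp
    also have "\<dots> \<longleftrightarrow> inj_on snd ?C"
    proof -
      have *: "card {c \<in> ?C. snd c = y} \<le> Suc 0 \<longleftrightarrow>
          (\<forall>c\<in>?C. \<forall>d\<in>?C. snd c = y \<longrightarrow> snd d = y \<longrightarrow> c = d)" for y
        using finC by (subst card_le_Suc0_iff_eq) (simp, blast)
      have "snd c \<in> columns T" if "c \<in> ?C" for c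
        using that sub in_rows(2) by blast
      then show ?thesis
        unfolding inj_on_def * by metis
    qed
    finally show ?thesis .
  qed
  moreover have "EC T F = A \<longleftrightarrow> snd ` ?C = {y \<in> columns T. column_label T y \<notin> A}"
  proof -
    have "{y \<in> columns T. \<forall>c\<in>T. snd c = y \<longrightarrow> F c = 0} = columns T - snd ` ?C"
      using True by (force simp: ones_def fillings_def PiE_def Pi_def)
    then have "EC T F = column_label T ` (columns T - snd ` ?C)"
      by (simp add: EC_def)
    moreover have "A = column_label T ` {y \<in> columns T. column_label T y \<in> A}"
      using A col(2) by auto
    ultimately have "EC T F = A \<longleftrightarrow>
        columns T - snd ` ?C = {y \<in> columns T. column_label T y \<in> A}"
      using inj_on_image_eq_iff[OF col(1), of "columns T - snd ` ?C"
        "{y \<in> columns T. column_label T y \<in> A}"] by auto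
    moreover have "snd ` ?C \<subseteq> columns T"
      using in_rows sub by auto
    ultimately show ?thesis by auto
  qed
  ultimately show ?thesis
    using True sub by (simp add: N_fillings_EC_def N_fillings_def configurations_def)
qed (simp add: N_fillings_EC_def N_fillings_def)

lemma N_fillings_EC_gf_swap:
  fixes p q :: "'a::comm_semiring_1"
  assumes moon: "moon_polyomino T"
  shows "(\<Sum>F\<in>N_fillings_EC T m A. p ^ ne2 T F * q ^ se2 T F) =
    (\<Sum>F\<in>N_fillings_EC T m A. p ^ se2 T F * q ^ ne2 T F)"
proof -
  have fin: "finite T"
    using moon by (simp add: moon_polyomino_def convex_polyomino_def polyomino_def)
  show ?thesis
  proof (cases "A \<subseteq> {1..num_columns T}")
    case True
    let ?M = "\<lambda>x. m (row_label T x)" and ?Y = "{y \<in> columns T. column_label T y \<notin> A}"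
    have "ones T ` N_fillings_EC T m A = configurations T ?M ?Y"
    proof -
      have "configurations T ?M ?Y \<subseteq> ones T ` fillings T"
        using bij_betw_ones[of T] by (auto simp: bij_betw_def configurations_def)
      then show ?thesis
        using N_fillings_EC_iff[OF fin True] by blast
    qed
    moreover have "inj_on (ones T) (N_fillings_EC T m A)"
      using bij_betw_ones[of T] N_fillings_EC_iff[OF fin True]
      by (auto simp: bij_betw_def inj_on_def)
    ultimately have gf: "(\<Sum>F\<in>N_fillings_EC T m A. p ^ ne2 T F * q ^ se2 T F) =
        configuration_gf T ?M ?Y p q" for p q :: 'a
      unfolding configuration_gf_def ne2_eq_card_chain_pairs se2_eq_card_chain_pairs
      by (subst sum.reindex_bij_betw[of "ones T" "N_fillings_EC T m A", symmetric])
        (simp_all add: bij_betw_def)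
    have "finite ?Y"
      using fin by (simp add: columns_def)
    \<comment> \<open>The induction result is applied with both column sets equal to
      \<open>?Y\<close>, so its cardinality conditions are trivial.\<close>
    then have "configuration_gf T ?M ?Y p q = configuration_gf T ?M ?Y q p"
      using moon by (intro configuration_gf_swap) auto
    then show ?thesis
      unfolding gf by (simp add: gf[symmetric] mult.commute)
  next
    case False
    have "EC T F \<subseteq> {1..num_columns T}" for F
      using bij_betw_imp_surj_on[OF column_label_bij_betw[OF fin]] by (auto simp: EC_def)
    then have "N_fillings_EC T m A = {}"
      using False by (auto simp: N_fillings_EC_def)
    then show ?thesis by simp
  qed
qed

section \<open>Transposition\<close>

lemma rows_converse [simp]: "rows (converse T) = columns T"
  and columns_converse [simp]: "columns (converse T) = rows T"
  by (force simp: rows_def columns_def)+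

lemma ball_converse: "(\<forall>c\<in>converse T. P c) \<longleftrightarrow> (\<forall>c\<in>T. P (prod.swap c))"
  by auto

lemma labels_converse [simp]:
  "row_label (converse T) = column_label T" "column_label (converse T) = row_label T"
  "num_rows (converse T) = num_columns T" "num_columns (converse T) = num_rows T"
  by (simp_all add: fun_eq_iff row_label_def column_label_def num_rows_def num_columns_def)

text \<open>Two incomparable columns would contain cells \<open>(x, y)\<close> and
  \<open>(x', y')\<close> with \<open>(x, y')\<close> and \<open>(x', y)\<close> outside
  \<open>T\<close>, which makes the rows \<open>x\<close> and \<open>x'\<close>
  incomparable.\<close>

lemma moon_polyomino_converse:
  assumes moon: "moon_polyomino T"
  shows "moon_polyomino (converse T)"
proof -
  have "finite T" "T \<noteq> {}"
    using moon by (simp_all add: moon_polyomino_def convex_polyomino_def polyomino_def)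
  then have "polyomino (converse T)"
    by (auto simp: polyomino_def)
  moreover have "(x, z) \<in> converse T"
    if "(x, y) \<in> converse T" "(x, y') \<in> converse T" "y \<le> z" "z \<le> y'" for x y y' z
    using that column_convex[OF moon, of y x y' z] by simp
  moreover have "(z, y) \<in> converse T"
    if "(x, y) \<in> converse T" "(x', y) \<in> converse T" "x \<le> z" "z \<le> x'" for x x' y z
    using that row_convex[OF moon, of y x x' z] by simp
  moreover have "intersection_free (converse T)"
    unfolding intersection_free_def
  proof (intro ballI)
    fix y y'
    show "{x. (y, x) \<in> converse T} \<subseteq> {x. (y', x) \<in> converse T} \<or>
        {x. (y', x) \<in> converse T} \<subseteq> {x. (y, x) \<in> converse T}"
    proof (rule ccontr)
      assume "\<not> ?thesis"
      then obtain x x' where "(x, y) \<in> T" "(x, y') \<notin> T" "(x', y') \<in> T" "(x', y) \<notin> T"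
        by auto
      moreover from this have "x \<in> rows T" "x' \<in> rows T"
        by (force simp: rows_def)+
      ultimately show False
        using row_columns_chain[OF moon, of x x'] by (auto simp: row_columns_def)
    qed
  qed
  ultimately show ?thesis
    unfolding moon_polyomino_def convex_polyomino_def by blast
qed

lemma ones_converse: "ones (converse T) (F \<circ> prod.swap) = prod.swap ` ones T F"
  by (auto simp: ones_def)

lemma bounding_rectangle_swap:
  "bounding_rectangle (prod.swap c) (prod.swap d) \<subseteq> converse T \<longleftrightarrow> bounding_rectangle c d \<subseteq> T"
  by (auto simp: bounding_rectangle_def)

text \<open>Transposing exchanges the vertical and the horizontal order of two cells, so the left cell of
  an ascent becomes the right one.\<close>

lemma ne2_converse: "ne2 (converse T) (F \<circ> prod.swap) = ne2 T F"
  unfolding ne2_eq_card_chain_pairs ones_converse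
  by (rule bij_betw_same_card[where f = "\<lambda>(c, d). (prod.swap d, prod.swap c)"],
      rule bij_betw_byWitness[where f' = "\<lambda>(c, d). (prod.swap d, prod.swap c)"])
    (auto simp: chain_pairs_def image_subset_iff
      bounding_rectangle_swap[of "(_, _)" "(_, _)", simplified] bounding_rectangle_commute del: subsetI)

lemma se2_converse: "se2 (converse T) (F \<circ> prod.swap) = se2 T F"
  unfolding se2_eq_card_chain_pairs ones_converse
  by (rule bij_betw_same_card[where f = "\<lambda>(c, d). (prod.swap c, prod.swap d)"],
      rule bij_betw_byWitness[where f' = "\<lambda>(c, d). (prod.swap c, prod.swap d)"])
    (auto simp: chain_pairs_def image_subset_iff
      bounding_rectangle_swap[of "(_, _)" "(_, _)", simplified] del: subsetI)

lemma counts_converse: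
  "row_count (converse T) (F \<circ> prod.swap) i = column_count T F i"
  "column_count (converse T) (F \<circ> prod.swap) i = row_count T F i"
proof -
  have "{c \<in> prod.swap ` ones T F. column_label T (fst c) = i} =
      prod.swap ` {c \<in> ones T F. column_label T (snd c) = i}"
    "{c \<in> prod.swap ` ones T F. row_label T (snd c) = i} =
      prod.swap ` {c \<in> ones T F. row_label T (fst c) = i}"
    by auto
  then show "row_count (converse T) (F \<circ> prod.swap) i = column_count T F i"
    "column_count (converse T) (F \<circ> prod.swap) i = row_count T F i"
    by (simp_all add: row_count_def column_count_def ones_converse card_image)
qed

lemma EC_converse: "EC (converse T) (F \<circ> prod.swap) = ER T F"
  by (simp add: EC_def ER_def ball_converse)

lemma fillings_converse: "F \<circ> prod.swap \<in> fillings (converse T) \<longleftrightarrow> F \<in> fillings T"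
  by (auto simp: fillings_def PiE_iff extensional_def ball_converse)

lemma bij_betw_N'_fillings_ER:
  "bij_betw (\<lambda>F. F \<circ> prod.swap) (N'_fillings_ER T m A) (N_fillings_EC (converse T) m A)"
proof -
  have iff: "F \<circ> prod.swap \<in> N_fillings_EC (converse T) m A \<longleftrightarrow> F \<in> N'_fillings_ER T m A" for F
    by (simp add: N_fillings_EC_def N_fillings_def N'_fillings_ER_def N'_fillings_def
      fillings_converse counts_converse EC_converse)
  have swap: "(F \<circ> prod.swap) \<circ> prod.swap = F" for F :: "cell \<Rightarrow> nat"
    by (simp add: comp_assoc)
  show ?thesis
  proof (rule bij_betw_byWitness[where f' = "\<lambda>F. F \<circ> prod.swap"])
    show "(\<lambda>F. F \<circ> prod.swap) ` N_fillings_EC (converse T) m A \<subseteq> N'_fillings_ER T m A"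
    proof (rule image_subsetI)
      fix F assume "F \<in> N_fillings_EC (converse T) m A"
      then show "F \<circ> prod.swap \<in> N'_fillings_ER T m A"
        using iff[of "F \<circ> prod.swap"] by (simp only: swap)
    qed
  qed (auto simp: swap iff simp del: o_apply)
qed

lemma N'_fillings_ER_gf_swap:
  fixes p q :: "'a::comm_semiring_1"
  assumes "moon_polyomino T"
  shows "(\<Sum>F\<in>N'_fillings_ER T m A. p ^ ne2 T F * q ^ se2 T F) =
    (\<Sum>F\<in>N'_fillings_ER T m A. p ^ se2 T F * q ^ ne2 T F)"
  using N_fillings_EC_gf_swap[OF moon_polyomino_converse[OF assms], where m = m and A = A and p = p and q = q]
  by (simp add: sum.reindex_bij_betw[OF bij_betw_N'_fillings_ER, symmetric] ne2_converse se2_converse)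

theorem theorem1p1:
  fixes T :: "cell set" and A :: "nat set"
  assumes "moon_polyomino T" and "A \<subseteq> {1..}"
  shows "(\<forall>m :: nat \<Rightarrow> int.
            (\<Sum>F\<in>N_fillings_EC T m A. indet_p ^ ne2 T F * indet_q ^ se2 T F) =
            (\<Sum>F\<in>N_fillings_EC T m A. indet_p ^ se2 T F * indet_q ^ ne2 T F)) \<and>
         (\<forall>m :: nat \<Rightarrow> int.
            (\<Sum>F\<in>N'_fillings_ER T m A. indet_p ^ ne2 T F * indet_q ^ se2 T F) =
            (\<Sum>F\<in>N'_fillings_ER T m A. indet_p ^ se2 T F * indet_q ^ ne2 T F))"
  \<comment> \<open>The identities hold in every commutative semiring and are specialised to the
    indeterminates.\<close>
  using N_fillings_EC_gf_swap[OF assms(1)] N'_fillings_ER_gf_swap[OF assms(1)] by blast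

end
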